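(* Let $\mathbb{K}$ be a field of characteristic different from $2$, let $X$ and $Y$ be linear spaces over $\mathbb{K}$, let $\alpha_{1},\alpha_{2},\beta_{1},\beta_{2}\in\mathbb{K}$ be non-zero, let $\gamma_{i,j}\in \mathbb{K}$, $i,j=1,2$, be given constants, and let $f\colon X\times Y\to \mathbb{K}$ be a function with $f(0,0)=0$. Then \[ f(\alpha_{1}x_{1}+\alpha_{2}x_{2},\beta_{1}y_{1}+\beta_{2}y_{2}) =\gamma_{1,1}f(x_{1},y_{1})+\gamma_{1,2}f(x_{1},y_{2})+\gamma_{2,1}f(x_{2},y_{1})+\gamma_{2,2}f(x_{2},y_{2}) \] holds for all $x_{1}, x_{2}\in X$ and $y_{1}, y_{2}\in Y$ if and only if there exist a bi-additive function $A\colon X\times Y\to \mathbb{K}$ and additive functions $\chi\colon X\to \mathbb{K}$ and $\zeta\colon Y\to \mathbb{K}$ such that \[ f(x,z)=A(x,z)+\chi(x)+\zeta(z) \qquad (x\in X,\ z\in Y) \] and, furthermore, \[ \begin{array}{rcl} \chi(\alpha_{1}x)&=&(\gamma_{1,1}+\gamma_{1,2})\chi(x)\\ \chi(\alpha_{2}x)&=&(\gamma_{2,1}+\gamma_{2,2})\chi(x)\\ \zeta(\beta_{1}z)&=&(\gamma_{1,1}+\gamma_{2,1})\zeta(z)\\ \zeta(\beta_{2}z)&=&(\gamma_{1,2}+\gamma_{2,2})\zeta(z)\\ A(\alpha_{i}x,\beta_{j}z)&=&\gamma_{i,j}A(x,z) \end{array} \qquad (x\in X,\ z\in Y,\ i,j=1,2).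 \]
   Context: A function between linear spaces is additive if it preserves sums; a mapping $A\colon X\times Y\to\mathbb{K}$ is bi-additive if it is additive in each of its two variables separately. *)

theory Defs
  imports Complex_Main
begin

definition biadditive ::
  "('x::ab_group_add \<times> 'y::ab_group_add \<Rightarrow> 'k::ab_group_add) \<Rightarrow> bool" where
  "biadditive A \<longleftrightarrow> (\<forall>y. additive (\<lambda>x. A (x, y))) \<and> (\<forall>x. additive (\<lambda>y. A (x, y)))"

end

theory Submission
  imports Defs
begin

text \<open>
  Writing \<open>\<chi> x = f (x, 0)\<close>, \<open>\<zeta> y = f (0, y)\<close> and \<open>A = f - \<chi> - \<zeta>\<close> splits the equation for \<open>f\<close> into
  separate equations for \<open>\<chi>\<close>, \<open>\<zeta>\<close> and \<open>A\<close>. Putting \<open>y\<^sub>1 = y\<^sub>2 = 0\<close> gives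
  \<open>\<chi> (\<alpha>\<^sub>1 x\<^sub>1 + \<alpha>\<^sub>2 x\<^sub>2) = (\<gamma>\<^sub>1\<^sub>1 + \<gamma>\<^sub>1\<^sub>2) \<chi> x\<^sub>1 + (\<gamma>\<^sub>2\<^sub>1 + \<gamma>\<^sub>2\<^sub>2) \<chi> x\<^sub>2\<close>, and \<open>x\<^sub>1 = x\<^sub>2 = 0\<close> gives its analogue for \<open>\<zeta>\<close>.
  Subtracting both leaves the original equation for \<open>A\<close>, which moreover vanishes on both axes;
  so with \<open>y\<^sub>2 = 0\<close> the terms containing \<open>y\<^sub>2\<close> drop out, and likewise for the other three arguments.
  All equations are thereby reduced to Pexider equations in one variable,
  \<open>g (\<alpha>\<^sub>1 x\<^sub>1 + \<alpha>\<^sub>2 x\<^sub>2) = h\<^sub>1 x\<^sub>1 + h\<^sub>2 x\<^sub>2\<close> with \<open>h\<^sub>1 0 = h\<^sub>2 0 = 0\<close>. Setting \<open>x\<^sub>2 = 0\<close> or \<open>x\<^sub>1 = 0\<close> there gives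
  the scaling rules (\<open>pexider_parts\<close>); these turn the right-hand side into
  \<open>g (\<alpha>\<^sub>1 x\<^sub>1) + g (\<alpha>\<^sub>2 x\<^sub>2)\<close>, which is additivity because multiplication by a nonzero scalar is onto
  (\<open>additive_of_pexider\<close>). Conversely, additivity splits \<open>f\<close> at the sums and the scaling rules bring
  out the coefficients.

  The lemmas are stated for maps \<open>a\<^sub>i\<close> and \<open>b\<^sub>j\<close> in place of multiplication by \<open>\<alpha>\<^sub>i\<close> and \<open>\<beta>\<^sub>j\<close>.
\<close>

lemma pexider_parts:
  fixes g :: "'x::ab_group_add \<Rightarrow> 'k::ab_group_add"
    and a1 a2 :: "'a::zero \<Rightarrow> 'x"
  assumes eq: "\<And>x1 x2. g (a1 x1 + a2 x2) = h1 x1 + h2 x2"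
    and zero: "a1 0 = 0" "a2 0 = 0" "h1 0 = 0" "h2 0 = 0"
  shows "g (a1 x) = h1 x" and "g (a2 x) = h2 x"
  using eq[of x 0] eq[of 0 x] zero by simp_all

lemma additive_of_pexider:
  fixes g :: "'x::ab_group_add \<Rightarrow> 'k::ab_group_add"
    and a1 a2 :: "'a::zero \<Rightarrow> 'x"
  assumes eq: "\<And>x1 x2. g (a1 x1 + a2 x2) = h1 x1 + h2 x2"
    and zero: "a1 0 = 0" "a2 0 = 0" "h1 0 = 0" "h2 0 = 0"
    and surj: "surj a1" "surj a2"
  shows "additive g"
proof
  fix u v
  obtain x1 x2 where "u = a1 x1" "v = a2 x2"
    using surj by (meson surjD)
  then show "g (u + v) = g u + g v"
    using eq[of x1 x2] pexider_parts[of g a1 a2 h1 h2, OF eq zero] by simp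
qed

text \<open>
  Freezing the second argument at \<open>b\<^sub>j y\<close>, by letting the other summand be \<open>0\<close>, leaves a Pexider
  equation in the first argument. Its parts give the four scaling rules; and since \<open>b\<^sub>1\<close> is onto,
  every second argument has the form \<open>b\<^sub>1 y\<close>, whence additivity in the first variable. Freezing the
  first argument at \<open>a\<^sub>1 x\<close> handles the second variable.
\<close>

lemma biadditive_of_four_term_equation:
  fixes A :: "'x::ab_group_add \<times> 'y::ab_group_add \<Rightarrow> 'k::ring"
  assumes eq: "\<And>x1 x2 y1 y2. A (a1 x1 + a2 x2, b1 y1 + b2 y2)
        = c11 * A (x1, y1) + c12 * A (x1, y2) + c21 * A (x2, y1) + c22 * A (x2, y2)"
    and axes: "\<And>x. A (x, 0) = 0" "\<And>y. A (0, y) = 0"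
    and zero: "a1 0 = 0" "a2 0 = 0" "b1 0 = 0" "b2 0 = 0"
    and surj: "surj a1" "surj a2" "surj b1" "surj b2"
  shows "biadditive A"
    and "A (a1 x, b1 y) = c11 * A (x, y)" and "A (a1 x, b2 y) = c12 * A (x, y)"
    and "A (a2 x, b1 y) = c21 * A (x, y)" and "A (a2 x, b2 y) = c22 * A (x, y)"
proof -
  have first1: "A (a1 x1 + a2 x2, b1 y) = c11 * A (x1, y) + c21 * A (x2, y)" for x1 x2 y
    using eq[of x1 x2 y 0] by (simp add: axes zero)
  have first2: "A (a1 x1 + a2 x2, b2 y) = c12 * A (x1, y) + c22 * A (x2, y)" for x1 x2 y
    using eq[of x1 x2 0 y] by (simp add: axes zero)
  have second1: "A (a1 x, b1 y1 + b2 y2) = c11 * A (x, y1) + c12 * A (x, y2)" for x y1 y2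
    using eq[of x 0 y1 y2] by (simp add: axes zero)
  show "A (a1 x, b1 y) = c11 * A (x, y)" "A (a2 x, b1 y) = c21 * A (x, y)"
    using pexider_parts[of "\<lambda>x. A (x, b1 y)" a1 a2 "\<lambda>x. c11 * A (x, y)" "\<lambda>x. c21 * A (x, y)",
        OF first1] by (simp_all add: axes zero)
  show "A (a1 x, b2 y) = c12 * A (x, y)" "A (a2 x, b2 y) = c22 * A (x, y)"
    using pexider_parts[of "\<lambda>x. A (x, b2 y)" a1 a2 "\<lambda>x. c12 * A (x, y)" "\<lambda>x. c22 * A (x, y)",
        OF first2] by (simp_all add: axes zero)
  have "additive (\<lambda>x. A (x, v))" for v
  proof -
    obtain y where "v = b1 y" using surj by (meson surjD)
    then show ?thesis
      using additive_of_pexider[of "\<lambda>x. A (x, b1 y)" a1 a2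
          "\<lambda>x. c11 * A (x, y)" "\<lambda>x. c21 * A (x, y)", OF first1]
      by (simp add: axes zero surj)
  qed
  moreover have "additive (\<lambda>y. A (u, y))" for u
  proof -
    obtain x where "u = a1 x" using surj by (meson surjD)
    then show ?thesis
      using additive_of_pexider[of "\<lambda>y. A (a1 x, y)" b1 b2
          "\<lambda>y. c11 * A (x, y)"
          "\<lambda>y. c12 * A (x, y)", OF second1]
      by (simp add: axes zero surj)
  qed
  ultimately show "biadditive A"
    by (simp add: biadditive_def)
qed

lemma (in vector_space) surj_scale:
  assumes "c \<noteq> 0"
  shows "surj (scale c)"
proof (rule surjI)
  show "scale c (scale (inverse c) x) = x" for x
    using assms by simp
qed

theorem proposition15:
  fixes scaleX :: "'k::field \<Rightarrow> 'x::ab_group_add \<Rightarrow> 'x" (infixr \<open>*\<^sub>X\<close> 75)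
    and scaleY :: "'k \<Rightarrow> 'y::ab_group_add \<Rightarrow> 'y" (infixr \<open>*\<^sub>Y\<close> 75)
    and \<alpha> \<beta> :: "nat \<Rightarrow> 'k"
    and \<gamma> :: "nat \<Rightarrow> nat \<Rightarrow> 'k"
    and f :: "'x \<times> 'y \<Rightarrow> 'k"
  assumes "CHAR('k) \<noteq> 2"
    and "vector_space scaleX"
    and "vector_space scaleY"
    and "\<alpha> 1 \<noteq> 0" and "\<alpha> 2 \<noteq> 0"
    and "\<beta> 1 \<noteq> 0" and "\<beta> 2 \<noteq> 0"
    and "f (0, 0) = 0"
  shows "(\<forall>x\<^sub>1 x\<^sub>2 y\<^sub>1 y\<^sub>2.
            f (\<alpha> 1 *\<^sub>X x\<^sub>1 + \<alpha> 2 *\<^sub>X x\<^sub>2, \<beta> 1 *\<^sub>Y y\<^sub>1 + \<beta> 2 *\<^sub>Y y\<^sub>2)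
            = \<gamma> 1 1 * f (x\<^sub>1, y\<^sub>1) + \<gamma> 1 2 * f (x\<^sub>1, y\<^sub>2)
              + \<gamma> 2 1 * f (x\<^sub>2, y\<^sub>1) + \<gamma> 2 2 * f (x\<^sub>2, y\<^sub>2))
     \<longleftrightarrow>
         (\<exists>(A :: 'x \<times> 'y \<Rightarrow> 'k) (\<chi> :: 'x \<Rightarrow> 'k) (\<zeta> :: 'y \<Rightarrow> 'k).
            biadditive A \<and> additive \<chi> \<and> additive \<zeta> \<and>
            (\<forall>x z. f (x, z) = A (x, z) + \<chi> x + \<zeta> z) \<and>
            (\<forall>x. \<chi> (\<alpha> 1 *\<^sub>X x) = (\<gamma> 1 1 + \<gamma> 1 2) * \<chi> x) \<and>
            (\<forall>x. \<chi> (\<alpha> 2 *\<^sub>X x) = (\<gamma> 2 1 + \<gamma> 2 2) * \<chi> x) \<and>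
            (\<forall>z. \<zeta> (\<beta> 1 *\<^sub>Y z) = (\<gamma> 1 1 + \<gamma> 2 1) * \<zeta> z) \<and>
            (\<forall>z. \<zeta> (\<beta> 2 *\<^sub>Y z) = (\<gamma> 1 2 + \<gamma> 2 2) * \<zeta> z) \<and>
            (\<forall>i\<in>{1, 2}. \<forall>j\<in>{1, 2}. \<forall>x z.
               A (\<alpha> i *\<^sub>X x, \<beta> j *\<^sub>Y z) = \<gamma> i j * A (x, z)))"
  (is "?equation \<longleftrightarrow> ?decomposition")
proof -
  interpret X: vector_space scaleX by fact
  interpret Y: vector_space scaleY by fact
  note surj = X.surj_scale[OF \<open>\<alpha> 1 \<noteq> 0\<close>] X.surj_scale[OF \<open>\<alpha> 2 \<noteq> 0\<close>]
    Y.surj_scale[OF \<open>\<beta> 1 \<noteq> 0\<close>] Y.surj_scale[OF \<open>\<beta> 2 \<noteq> 0\<close>]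
  show ?thesis
  proof
    assume E: ?equation
    define \<chi> where "\<chi> x = f (x, 0)" for x
    define \<zeta> where "\<zeta> y = f (0, y)" for y
    define A where "A p = f p - \<chi> (fst p) - \<zeta> (snd p)" for p
    have zero: "\<chi> 0 = 0" "\<zeta> 0 = 0"
      using \<open>f (0, 0) = 0\<close> by (simp_all add: \<chi>_def \<zeta>_def)
    have axes: "A (x, 0) = 0" "A (0, y) = 0" for x y
      using zero by (simp_all add: A_def \<chi>_def \<zeta>_def)
    have \<chi>_eq: "\<chi> (\<alpha> 1 *\<^sub>X x1 + \<alpha> 2 *\<^sub>X x2)
        = (\<gamma> 1 1 + \<gamma> 1 2) * \<chi> x1 + (\<gamma> 2 1 + \<gamma> 2 2) * \<chi> x2" for x1 x2
      using E[rule_format, of x1 x2 0 0] by (simp add: \<chi>_def algebra_simps)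
    have \<zeta>_eq: "\<zeta> (\<beta> 1 *\<^sub>Y y1 + \<beta> 2 *\<^sub>Y y2)
        = (\<gamma> 1 1 + \<gamma> 2 1) * \<zeta> y1 + (\<gamma> 1 2 + \<gamma> 2 2) * \<zeta> y2" for y1 y2
      using E[rule_format, of 0 0 y1 y2] by (simp add: \<zeta>_def algebra_simps)
    have A_eq: "A (\<alpha> 1 *\<^sub>X x1 + \<alpha> 2 *\<^sub>X x2, \<beta> 1 *\<^sub>Y y1 + \<beta> 2 *\<^sub>Y y2)
        = \<gamma> 1 1 * A (x1, y1) + \<gamma> 1 2 * A (x1, y2)
          + \<gamma> 2 1 * A (x2, y1) + \<gamma> 2 2 * A (x2, y2)" for x1 x2 y1 y2
      using E[rule_format, of x1 x2 y1 y2] \<chi>_eq[of x1 x2] \<zeta>_eq[of y1 y2]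
      by (simp add: A_def algebra_simps)
    have "additive \<chi>" "\<chi> (\<alpha> 1 *\<^sub>X x) = (\<gamma> 1 1 + \<gamma> 1 2) * \<chi> x"
        "\<chi> (\<alpha> 2 *\<^sub>X x) = (\<gamma> 2 1 + \<gamma> 2 2) * \<chi> x" for x
      using additive_of_pexider[of \<chi> "scaleX (\<alpha> 1)" "scaleX (\<alpha> 2)"
          "\<lambda>t. (\<gamma> 1 1 + \<gamma> 1 2) * \<chi> t"
          "\<lambda>t. (\<gamma> 2 1 + \<gamma> 2 2) * \<chi> t", OF \<chi>_eq]
        pexider_parts[of \<chi> "scaleX (\<alpha> 1)" "scaleX (\<alpha> 2)"
          "\<lambda>t. (\<gamma> 1 1 + \<gamma> 1 2) * \<chi> t"
          "\<lambda>t. (\<gamma> 2 1 + \<gamma> 2 2) * \<chi> t", OF \<chi>_eq]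
      by (simp_all add: zero surj del: One_nat_def)
    moreover have "additive \<zeta>" "\<zeta> (\<beta> 1 *\<^sub>Y y) = (\<gamma> 1 1 + \<gamma> 2 1) * \<zeta> y"
        "\<zeta> (\<beta> 2 *\<^sub>Y y) = (\<gamma> 1 2 + \<gamma> 2 2) * \<zeta> y" for y
      using additive_of_pexider[of \<zeta> "scaleY (\<beta> 1)" "scaleY (\<beta> 2)"
          "\<lambda>t. (\<gamma> 1 1 + \<gamma> 2 1) * \<zeta> t"
          "\<lambda>t. (\<gamma> 1 2 + \<gamma> 2 2) * \<zeta> t", OF \<zeta>_eq]
        pexider_parts[of \<zeta> "scaleY (\<beta> 1)" "scaleY (\<beta> 2)"
          "\<lambda>t. (\<gamma> 1 1 + \<gamma> 2 1) * \<zeta> t"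
          "\<lambda>t. (\<gamma> 1 2 + \<gamma> 2 2) * \<zeta> t", OF \<zeta>_eq]
      by (simp_all add: zero surj del: One_nat_def)
    moreover have "biadditive A"
        "\<forall>i\<in>{1, 2}. \<forall>j\<in>{1, 2}. \<forall>x z. A (\<alpha> i *\<^sub>X x, \<beta> j *\<^sub>Y z) = \<gamma> i j * A (x, z)"
      using biadditive_of_four_term_equation[of A "scaleX (\<alpha> 1)" "scaleX (\<alpha> 2)"
          "scaleY (\<beta> 1)" "scaleY (\<beta> 2)", OF A_eq]
      by (simp_all add: axes surj del: One_nat_def)
    moreover have "f (x, z) = A (x, z) + \<chi> x + \<zeta> z" for x z
      by (simp add: A_def)
    ultimately show ?decomposition
      by blast
  next
    assume ?decomposition
    then obtain A \<chi> \<zeta> where A: "biadditive A" and \<chi>: "additive \<chi>" and \<zeta>: "additive \<zeta>"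
      and f: "\<And>x z. f (x, z) = A (x, z) + \<chi> x + \<zeta> z"
      and \<chi>_scale: "\<And>x. \<chi> (\<alpha> 1 *\<^sub>X x) = (\<gamma> 1 1 + \<gamma> 1 2) * \<chi> x"
        "\<And>x. \<chi> (\<alpha> 2 *\<^sub>X x) = (\<gamma> 2 1 + \<gamma> 2 2) * \<chi> x"
      and \<zeta>_scale: "\<And>z. \<zeta> (\<beta> 1 *\<^sub>Y z) = (\<gamma> 1 1 + \<gamma> 2 1) * \<zeta> z"
        "\<And>z. \<zeta> (\<beta> 2 *\<^sub>Y z) = (\<gamma> 1 2 + \<gamma> 2 2) * \<zeta> z"
      and A_scale: "\<forall>i\<in>{1, 2}. \<forall>j\<in>{1, 2}. \<forall>x z.
        A (\<alpha> i *\<^sub>X x, \<beta> j *\<^sub>Y z) = \<gamma> i j * A (x, z)"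
      by blast
    have A_first: "A (x + x', y) = A (x, y) + A (x', y)" for x x' y
      using A additive.add[of "\<lambda>x. A (x, y)"] by (simp add: biadditive_def)
    have A_second: "A (x, y + y') = A (x, y) + A (x, y')" for x y y'
      using A additive.add[of "\<lambda>y. A (x, y)"] by (simp add: biadditive_def)
    have A_scales: "A (\<alpha> 1 *\<^sub>X x, \<beta> 1 *\<^sub>Y z) = \<gamma> 1 1 * A (x, z)"
        "A (\<alpha> 1 *\<^sub>X x, \<beta> 2 *\<^sub>Y z) = \<gamma> 1 2 * A (x, z)"
        "A (\<alpha> 2 *\<^sub>X x, \<beta> 1 *\<^sub>Y z) = \<gamma> 2 1 * A (x, z)"
        "A (\<alpha> 2 *\<^sub>X x, \<beta> 2 *\<^sub>Y z) = \<gamma> 2 2 * A (x, z)" for x z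
      using A_scale by blast+
    show ?equation
      unfolding f A_first A_second additive.add[OF \<chi>] additive.add[OF \<zeta>]
        A_scales \<chi>_scale \<zeta>_scale
      by (simp add: algebra_simps)
  qed
qed

end
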